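(* Let $M\in\mathbb{R}^{n\times n}$ be symmetric positive definite. Consider iteration $k$ of the exact linesearch method (described in the context) applied to the minimization of $\frac12 x^THx+c^Tx$ with $H=H^T\succ0$, where $1\le k<r$. Assume that $p_i=\delta_i p_i^{PCG}$ with $\delta_i\ne 0$ for $i=0,\dots,k-1$, where $p_i^{PCG}$, $i=0,\dots,k-1$, are the search directions of the preconditioned method of conjugate gradients with preconditioning matrix $M$. Let $B_k$ and $p_k$ satisfy $B_kp_k=-g_k$, and let $B_{k-1}\in\mathbb{R}^{n\times n}$ be a nonsingular matrix such that $B_{k-1}p_{k-1}=-g_{k-1}$ and $B_{k-1}M^{-1}g_k=g_k$. Let $\hat\gamma_k$, $\gamma_k(\cdot)$ and $\delta_k(\cdot)$ be as defined in the context. (1) For any scalar $\gamma_k$, except $\gamma_k=0$, $\gamma_k=\hat\gamma_k$ and $\gamma_k=1$, let $B_k$ be defined by $$( * )\qquad B_k=B_{k-1}-\frac1{(\gamma_k-1)\,p_{k-1}^Tg_{k-1}}(\gamma_kg_k-g_{k-1})(\gamma_kg_k-g_{k-1})^T.$$ Then $B_k$ is nonsingular and $p_k=\delta_kp_k^{PCG}$ for $\delta_k=\delta_k(\gamma_k)$. (2) Conversely, for any scalar $\delta_k$, except $\delta_k=0$, $\delta_k=\delta_k(1)$ and $\delta_k=1$, assume that $p_k=\delta_kp_k^{PCG}$ and assume that $B_k-B_{k-1}$ is symmetric and of rank one. Then $B_k$ is a nonsingular matrix given by $( * )$ for $\gamma_k=\gamma_k(\delta_k)$. (3) If, in addition,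 $B_{k-1}=B_{k-1}^T\succ0$, then $B_k$ defined by $( * )$ (with $\gamma_k\notin\{0,\hat\gamma_k,1\}$) satisfies $B_k\succ0$ if and only if $\gamma_k>1$ or $\hat\gamma_k<\gamma_k<0$, or equivalently if and only if $\gamma_k=\gamma_k(\delta_k)$ for $0<\delta_k<\delta_k(1)$ or $\delta_k>1$. (4) Finally, if $B_ip_i=-g_i$, $i=0,\dots,k$, with $B_0=M$, and if, for $i=1,\dots,k$, $B_{i-1}$ is updated to $B_i$ according to $( * )$ (with $k$ replaced by $i$) for $\gamma_i$ such that $\gamma_i\ne0$, $\gamma_i\ne\hat\gamma_i$ and $\gamma_i\ne1$, then $$B_kp_i=\frac{\gamma_{i+1}\theta_i}{\gamma_{i+1}-1}Hp_i,\qquad i=0,\dots,k-1.$$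
   Context: Let $H\in\mathbb{R}^{n\times n}$ with $H=H^T\succ0$ and $c\in\mathbb{R}^n$. Here $X\succ0$ means that $X$ is positive definite, i.e. $x^TXx>0$ for all $x\neq0$. Exact linesearch method: given $x_0\in\mathbb{R}^n$, set $g_0=Hx_0+c$; for $k=0,1,\dots$, as long as $g_k\ne0$, choose a search direction $p_k$ and set $$\theta_k=-\frac{g_k^Tp_k}{p_k^THp_k},\quad x_{k+1}=x_k+\theta_kp_k,\quad g_{k+1}=g_k+\theta_kHp_k .$$ The index $r$ denotes the iteration at which the method terminates, i.e. the first index with $g_r=0$; so $k<r$ means $g_0,\dots,g_k$ are all nonzero. The preconditioned method of conjugate gradients (PCG) with symmetric positive definite preconditioning matrix $M$ is the exact linesearch method with search directions $p_0^{PCG}=-M^{-1}g_0$ and $p_k^{PCG}=-M^{-1}g_k+\frac{g_k^TM^{-1}g_k}{g_{k-1}^TM^{-1}g_{k-1}}p_{k-1}^{PCG}$ for $k\ge1$. PCG and the method under consideration are started from the same $x_0$; when $p_i=\delta_ip_i^{PCG}$ with $\delta_i\neq0$ for $i=0,\dots,k-1$, the iterates $x_i$ and gradients $g_i$, $i=0,\dots,k$, of the two methods coincide. Define $\hat\gamma_k=\dfrac{p_{k-1}^Tg_{k-1}}{g_k^TM^{-1}g_k}$ (and $\hat\gamma_i$ likewise for other indices $i\ge1$), and for $\delta_k\ne0$ and $\gamma_k\ne\hat\gamma_k$ define the functions $$\gamma_k(\delta_k)=-\frac{p_{k-1}^Tg_{k-1}}{g_k^TM^{-1}g_k}\Big(\frac1{\delta_k}-1\Big),\qquad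 \delta_k(\gamma_k)=\frac1{1-\gamma_k\frac{g_k^TM^{-1}g_k}{p_{k-1}^Tg_{k-1}}},$$ which are inverses of each other. *)

theory Defs
  imports "HOL-Analysis.Analysis"
begin

(* Positive definiteness alone; symmetry is always stated separately. *)
definition pos_def :: "real^'n^'n \<Rightarrow> bool" where
  "pos_def X \<longleftrightarrow> (\<forall>x. x \<noteq> 0 \<longrightarrow> x \<bullet> (X *v x) > 0)"

definition outer :: "real^'n \<Rightarrow> real^'n \<Rightarrow> real^'n^'n" where
  "outer u v = (\<chi> i j. u $ i * v $ j)"

(* A run of the exact linesearch method.  The recurrences are imposed only while the
   method has not terminated; later members of the sequences are unconstrained. *)
definition exact_linesearch ::
  "real^'n^'n \<Rightarrow> real^'n \<Rightarrow> (nat \<Rightarrow> real^'n) \<Rightarrow> (nat \<Rightarrow> real^'n) \<Rightarrow> (nat \<Rightarrow> real^'n) \<Rightarrow> (nat \<Rightarrow> real) \<Rightarrow> bool"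
  where
  "exact_linesearch H c x g p \<theta> \<longleftrightarrow>
     g 0 = H *v x 0 + c \<and>
     (\<forall>i. (\<forall>j\<le>i. g j \<noteq> 0) \<longrightarrow>
        \<theta> i = - (g i \<bullet> p i) / (p i \<bullet> (H *v p i)) \<and>
        x (Suc i) = x i + \<theta> i *\<^sub>R p i \<and>
        g (Suc i) = g i + \<theta> i *\<^sub>R (H *v p i))"

definition pcg ::
  "real^'n^'n \<Rightarrow> real^'n \<Rightarrow> real^'n^'n \<Rightarrow> (nat \<Rightarrow> real^'n) \<Rightarrow> (nat \<Rightarrow> real^'n) \<Rightarrow> (nat \<Rightarrow> real^'n) \<Rightarrow> (nat \<Rightarrow> real) \<Rightarrow> bool"
  where
  "pcg H c M x g p \<theta> \<longleftrightarrow>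
     exact_linesearch H c x g p \<theta> \<and>
     (g 0 \<noteq> 0 \<longrightarrow> p 0 = - (matrix_inv M *v g 0)) \<and>
     (\<forall>i\<ge>1. (\<forall>j\<le>i. g j \<noteq> 0) \<longrightarrow>
        p i = - (matrix_inv M *v g i)
              + ((g i \<bullet> (matrix_inv M *v g i)) / (g (i - 1) \<bullet> (matrix_inv M *v g (i - 1)))) *\<^sub>R p (i - 1))"

(* In the next four definitions the index i is meant to be at least 1. *)

definition gamma_hat ::
  "real^'n^'n \<Rightarrow> (nat \<Rightarrow> real^'n) \<Rightarrow> (nat \<Rightarrow> real^'n) \<Rightarrow> nat \<Rightarrow> real" where
  "gamma_hat M g p i = (p (i - 1) \<bullet> g (i - 1)) / (g i \<bullet> (matrix_inv M *v g i))"

definition gamma_of ::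
  "real^'n^'n \<Rightarrow> (nat \<Rightarrow> real^'n) \<Rightarrow> (nat \<Rightarrow> real^'n) \<Rightarrow> nat \<Rightarrow> real \<Rightarrow> real" where
  "gamma_of M g p i d =
     - ((p (i - 1) \<bullet> g (i - 1)) / (g i \<bullet> (matrix_inv M *v g i))) * (1 / d - 1)"

(* Meaningful for t different from gamma_hat M g p i; at t = gamma_hat M g p i the
   denominator vanishes and the value is 0 by the convention for division by zero. *)
definition delta_of ::
  "real^'n^'n \<Rightarrow> (nat \<Rightarrow> real^'n) \<Rightarrow> (nat \<Rightarrow> real^'n) \<Rightarrow> nat \<Rightarrow> real \<Rightarrow> real" where
  "delta_of M g p i t =
     1 / (1 - t * ((g i \<bullet> (matrix_inv M *v g i)) / (p (i - 1) \<bullet> g (i - 1))))"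

definition rank_one_update ::
  "real^'n^'n \<Rightarrow> (nat \<Rightarrow> real^'n) \<Rightarrow> (nat \<Rightarrow> real^'n) \<Rightarrow> nat \<Rightarrow> real \<Rightarrow> real^'n^'n" where
  "rank_one_update B g p i t =
     B - (1 / ((t - 1) * (p (i - 1) \<bullet> g (i - 1)))) *\<^sub>R
           outer (t *\<^sub>R g i - g (i - 1)) (t *\<^sub>R g i - g (i - 1))"

end

theory Submission
  imports Defs
begin

text \<open>
  Write \<open>W\<close> for the inverse of \<open>M\<close>, \<open>a = g\<^sub>k\<^sup>T W g\<^sub>k\<close>, \<open>s = p\<^sub>k\<^sub>-\<^sub>1\<^sup>T g\<^sub>k\<^sub>-\<^sub>1\<close> and \<open>u = t g\<^sub>k - g\<^sub>k\<^sub>-\<^sub>1\<close>.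
  The orthogonality relations of PCG give \<open>p\<^sub>k\<^sup>P\<^sup>C\<^sup>G = - W g\<^sub>k - (a/s) p\<^sub>k\<^sub>-\<^sub>1\<close>, and the two secant-type
  conditions on \<open>B\<^sub>k\<^sub>-\<^sub>1\<close> give \<open>B\<^sub>k\<^sub>-\<^sub>1 (t W g\<^sub>k + p\<^sub>k\<^sub>-\<^sub>1) = u\<close> with \<open>u\<^sup>T (t W g\<^sub>k + p\<^sub>k\<^sub>-\<^sub>1) = t\<^sup>2 a - s\<close>.
  Nonsingularity and definiteness of the update are therefore decided by the scalar
  \<open>1 - (t\<^sup>2 a - s) / ((t - 1) s) = t (s - t a) / ((t - 1) s)\<close>, while \<open>u\<^sup>T p\<^sub>k\<^sup>P\<^sup>C\<^sup>G = - a (t - 1)\<close> shows that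
  the updated matrix maps \<open>p\<^sub>k\<^sup>P\<^sup>C\<^sup>G\<close> to \<open>- (1 - t a/s) g\<^sub>k\<close>.  Conversely, a symmetric rank-one matrix
  is determined by its nonzero value at a single vector.  Finally, \<open>B\<^sub>i\<^sub>+\<^sub>1 p\<^sub>i\<close> is a multiple of
  \<open>g\<^sub>i\<^sub>+\<^sub>1 - g\<^sub>i\<close>, and later updates do not change it because later gradients are orthogonal to \<open>p\<^sub>i\<close>.
\<close>

section \<open>Rank-one modifications\<close>

lemma outer_mult_vec: "outer u v *v x = (v \<bullet> x) *\<^sub>R u"
  by (simp add: outer_def matrix_vector_mult_def vec_eq_iff inner_vec_def sum_distrib_left
      algebra_simps)

lemma rank_one_diff_mult_vec:
  fixes B :: "real^'n^'n"
  shows "(B - b *\<^sub>R outer u u) *v x = B *v x - (b * (u \<bullet> x)) *\<^sub>R u"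
  by (simp add: matrix_vector_mult_diff_rdistrib outer_mult_vec
      flip: scaleR_matrix_vector_assoc)

lemma symmetric_inner_mult_vec:
  fixes A :: "real^'n^'n"
  assumes "transpose A = A"
  shows "x \<bullet> (A *v y) = (A *v x) \<bullet> y"
  by (metis assms dot_lmul_matrix vector_transpose_matrix)

lemma invertible_iff_ker:
  fixes A :: "real^'n^'n"
  shows "invertible A \<longleftrightarrow> (\<forall>x. A *v x = 0 \<longrightarrow> x = 0)"
  by (simp add: invertible_left_inverse matrix_left_invertible_ker)

lemma pos_def_imp_invertible: "pos_def A \<Longrightarrow> invertible A"
  unfolding invertible_iff_ker pos_def_def by (metis inner_zero_right less_irrefl)

lemma matrix_inv_mult_vec:
  fixes A :: "real^'n^'n"
  assumes "invertible A"
  shows "A *v (matrix_inv A *v x) = x"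
  proof -
  have "A ** matrix_inv A = mat 1"
    using someI_ex[OF assms[unfolded invertible_def]] by (simp add: matrix_inv_def)
  then show ?thesis by (simp add: matrix_vector_mul_assoc)
qed

lemma matrix_inv_inner_commute:
  fixes A :: "real^'n^'n"
  assumes "transpose A = A" "invertible A"
  shows "x \<bullet> (matrix_inv A *v y) = y \<bullet> (matrix_inv A *v x)"
  by (metis assms inner_commute matrix_inv_mult_vec symmetric_inner_mult_vec)

lemma matrix_inv_inner_pos:
  assumes "pos_def A" "x \<noteq> 0"
  shows "x \<bullet> (matrix_inv A *v x) > 0"
proof -
  let ?y = "matrix_inv A *v x"
  have y: "A *v ?y = x" using matrix_inv_mult_vec pos_def_imp_invertible assms(1) by blast
  then have "?y \<noteq> 0" using assms(2) by auto
  with assms(1) have "?y \<bullet> (A *v ?y) > 0" by (simp add: pos_def_def)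
  then show ?thesis by (simp add: y inner_commute)
qed

text \<open>A kernel vector \<open>x\<close> satisfies
  \<open>B *v x = (b * (u \<bullet> x)) *\<^sub>R u\<close>, so injectivity of \<open>B\<close>
  makes it a multiple of \<open>y\<close>; pairing with \<open>u\<close> leaves the Sherman-Morrison
  scalar \<open>1 - b * (u \<bullet> y)\<close> times \<open>u \<bullet> x\<close>.\<close>

lemma invertible_rank_one_diff:
  fixes B :: "real^'n^'n"
  assumes B: "invertible B" and y: "B *v y = u" and nz: "b * (u \<bullet> y) \<noteq> 1"
  shows "invertible (B - b *\<^sub>R outer u u)"
  unfolding invertible_iff_ker
proof (intro allI impI)
  fix x assume "(B - b *\<^sub>R outer u u) *v x = 0"
  then have "B *v x = (b * (u \<bullet> x)) *\<^sub>R u"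
    by (simp add: rank_one_diff_mult_vec)
  then have "B *v (x - (b * (u \<bullet> x)) *\<^sub>R y) = 0"
    by (simp add: matrix_vector_mult_diff_distrib matrix_vector_mult_scaleR y)
  then have x: "x = (b * (u \<bullet> x)) *\<^sub>R y"
    using B unfolding invertible_iff_ker by fastforce
  then have "u \<bullet> x = (b * (u \<bullet> x)) * (u \<bullet> y)"
    by (metis inner_scaleR_right)
  then have "(u \<bullet> x) * (1 - b * (u \<bullet> y)) = 0"
    by (simp add: algebra_simps)
  then have "u \<bullet> x = 0" using nz by simp
  with x show "x = 0" by simp
qed

text \<open>The vector \<open>?z\<close> is \<open>q\<close> times the component of \<open>x\<close>
  that is \<open>B\<close>-orthogonal to \<open>y\<close>; its form value is nonnegative and equals
  \<open>q\<close> times the difference of the two sides.\<close>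

lemma pos_def_Cauchy_Schwarz:
  fixes B :: "real^'n^'n"
  assumes sym: "transpose B = B" and pd: "pos_def B"
  shows "(x \<bullet> (B *v y))\<^sup>2 \<le> (x \<bullet> (B *v x)) * (y \<bullet> (B *v y))"
proof (cases "y = 0")
  case False
  define q where "q = y \<bullet> (B *v y)"
  define r where "r = x \<bullet> (B *v y)"
  have q: "q > 0" using pd False by (simp add: q_def pos_def_def)
  let ?z = "q *\<^sub>R x - r *\<^sub>R y"
  have yx: "y \<bullet> (B *v x) = r"
    using symmetric_inner_mult_vec[OF sym, of y x] by (simp add: r_def inner_commute)
  have "0 \<le> ?z \<bullet> (B *v ?z)"
    using pd by (cases "?z = 0") (auto simp: pos_def_def less_imp_le)
  also have "\<dots> = q * (q * (x \<bullet> (B *v x)) - r\<^sup>2)"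
    by (simp add: matrix_vector_mult_diff_distrib matrix_vector_mult_scaleR inner_diff
        yx flip: q_def r_def) (simp add: algebra_simps power2_eq_square)
  finally show ?thesis using q
    by (simp add: zero_le_mult_iff mult.commute flip: q_def r_def)
qed simp

text \<open>The vector \<open>y\<close> is the critical direction. Testing the form there gives
  \<open>(u \<bullet> y) * (1 - b * (u \<bullet> y))\<close>, hence necessity. Since
  \<open>u = B *v y\<close>, the Cauchy-Schwarz inequality for \<open>B\<close> bounds the
  subtracted term in every other direction.\<close>

lemma pos_def_rank_one_diff_iff:
  fixes B :: "real^'n^'n"
  assumes sym: "transpose B = B" and pd: "pos_def B" and y: "B *v y = u" and u: "u \<noteq> 0"
  shows "pos_def (B - b *\<^sub>R outer u u) \<longleftrightarrow> b * (u \<bullet> y) < 1"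
proof
  have y0: "y \<noteq> 0" using y u by auto
  have q: "u \<bullet> y > 0"
    using pd y0 y by (auto simp: pos_def_def inner_commute)
  have form: "x \<bullet> ((B - b *\<^sub>R outer u u) *v x) = x \<bullet> (B *v x) - b * (u \<bullet> x)\<^sup>2" for x
    by (simp add: rank_one_diff_mult_vec inner_diff inner_commute power2_eq_square)
  {
    assume "pos_def (B - b *\<^sub>R outer u u)"
    then have "0 < y \<bullet> (B *v y) - b * (u \<bullet> y)\<^sup>2"
      using y0 unfolding pos_def_def form by blast
    also have "\<dots> = (u \<bullet> y) * (1 - b * (u \<bullet> y))"
      by (simp add: y inner_commute power2_eq_square algebra_simps)
    finally show "b * (u \<bullet> y) < 1" using q by (simp add: zero_less_mult_iff)
  next
    assume lt: "b * (u \<bullet> y) < 1"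
    show "pos_def (B - b *\<^sub>R outer u u)"
      unfolding pos_def_def form
    proof (intro allI impI)
      fix x :: "real^'n" assume "x \<noteq> 0"
      then have X: "x \<bullet> (B *v x) > 0" using pd by (simp add: pos_def_def)
      show "0 < x \<bullet> (B *v x) - b * (u \<bullet> x)\<^sup>2"
      proof (cases "b \<le> 0")
        case True
        then have "b * (u \<bullet> x)\<^sup>2 \<le> 0" by (simp add: mult_nonpos_nonneg)
        with X show ?thesis by linarith
      next
        case False
        have "(u \<bullet> x)\<^sup>2 \<le> (x \<bullet> (B *v x)) * (u \<bullet> y)"
          using pos_def_Cauchy_Schwarz[OF sym pd, of x y] by (simp add: y inner_commute)
        then have "b * (u \<bullet> x)\<^sup>2 \<le> b * ((x \<bullet> (B *v x)) * (u \<bullet> y))"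
          using False by (intro mult_left_mono) auto
        also have "\<dots> = (x \<bullet> (B *v x)) * (b * (u \<bullet> y))" by simp
        also have "\<dots> < (x \<bullet> (B *v x)) * 1"
          using X lt by (rule mult_strict_left_mono[rotated])
        finally show ?thesis by simp
      qed
    qed
  }
qed

text \<open>The range is the line through \<open>w\<close>, so
  \<open>A *v x = f x *\<^sub>R w\<close>. Symmetry then forces
  \<open>f x * (w \<bullet> p) = w \<bullet> x\<close>, and taking \<open>x = w\<close> shows that
  the factor \<open>w \<bullet> p\<close> is nonzero.\<close>

lemma symmetric_rank_one_eq_outer:
  fixes A :: "real^'n^'n"
  assumes sym: "transpose A = A" and rank: "rank A = 1" and p: "A *v p = w" and w: "w \<noteq> 0"
  shows "w \<bullet> p \<noteq> 0" and "A = (1 / (w \<bullet> p)) *\<^sub>R outer w w"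
proof -
  have sub: "subspace (range ((*v) A))"
    by (intro linear_subspace_image matrix_vector_mul_linear subspace_UNIV)
  have "range ((*v) A) = span {w}"
  proof (rule HOL.sym, rule subspace_dim_equal)
    show "span {w} \<subseteq> range ((*v) A)" using p by (intro span_minimal sub) auto
    show "dim (span {w}) \<ge> dim (range ((*v) A))"
      using rank w by (simp add: rank_dim_range)
  qed (use sub in auto)
  then have "\<exists>f. A *v x = f *\<^sub>R w" for x
    by (metis rangeI span_singleton rangeE)
  then obtain f where f: "\<And>x. A *v x = f x *\<^sub>R w" by metis
  have fw: "f x * (w \<bullet> p) = w \<bullet> x" for x
    using symmetric_inner_mult_vec[OF sym, of x p] unfolding p
    by (simp add: f inner_commute)
  show nz: "w \<bullet> p \<noteq> 0" using fw[of w] w by auto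
  show "A = (1 / (w \<bullet> p)) *\<^sub>R outer w w"
  proof (subst matrix_eq, intro allI)
    fix x
    have "f x = (w \<bullet> x) / (w \<bullet> p)" using fw nz by (simp add: field_simps)
    then show "A *v x = ((1 / (w \<bullet> p)) *\<^sub>R outer w w) *v x"
      by (simp add: f outer_mult_vec flip: scaleR_matrix_vector_assoc)
  qed
qed

section \<open>Orthogonality relations of PCG\<close>

text \<open>All relations are proved in one strong induction because they feed each other: the
  linesearch and conjugacy give \<open>g n\<close> orthogonal to earlier directions; the recurrence
  solved for \<open>W g j\<close> expresses it through \<open>p j\<close> and
  \<open>p (j - 1)\<close>, which gives orthogonality with respect to \<open>W\<close>; conjugacy
  follows since \<open>H p j\<close> is a multiple of a gradient difference.\<close>

lemma pcg_orthogonality: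
  fixes H M :: "real^'n^'n"
  assumes H_sym: "transpose H = H" and H_pd: "pos_def H"
    and M_sym: "transpose M = M" and M_pd: "pos_def M"
    and pcg: "pcg H c M x g p \<theta>"
    and nz: "\<forall>i\<le>N. g i \<noteq> 0"
    and "n \<le> N"
  shows "g n \<bullet> p n = - (g n \<bullet> (matrix_inv M *v g n)) \<and>
    (\<forall>j<n. g n \<bullet> p j = 0 \<and> g n \<bullet> (matrix_inv M *v g j) = 0 \<and> p n \<bullet> (H *v p j) = 0)"
  using \<open>n \<le> N\<close>
proof (induction n rule: less_induct)
  case (less n)
  let ?W = "matrix_inv M"
  have Wpos: "g i \<bullet> (?W *v g i) > 0" if "i \<le> N" for i
    using matrix_inv_inner_pos[OF M_pd] nz that by blast
  have p0: "p 0 = - (?W *v g 0)" using pcg nz by (auto simp: pcg_def)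
  have pSuc: "p (Suc i) = - (?W *v g (Suc i))
      + ((g (Suc i) \<bullet> (?W *v g (Suc i))) / (g i \<bullet> (?W *v g i))) *\<^sub>R p i" if "Suc i \<le> N" for i
  proof -
    have "\<forall>j\<le>Suc i. g j \<noteq> 0" using nz that by auto
    moreover have "1 \<le> Suc i" by simp
    ultimately show ?thesis using pcg unfolding pcg_def by (metis diff_Suc_1)
  qed
  have step: "\<theta> i = - (g i \<bullet> p i) / (p i \<bullet> (H *v p i))"
    "g (Suc i) = g i + \<theta> i *\<^sub>R (H *v p i)" if "i \<le> N" for i
    using pcg nz that unfolding pcg_def exact_linesearch_def by (meson le_trans)+
  show ?case
  proof (cases n)
    case 0
    then show ?thesis by (simp add: p0)
  next
    case (Suc m)
    have mN: "m \<le> N" using Suc less.prems by simp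
    have IH: "g i \<bullet> p i = - (g i \<bullet> (?W *v g i))"
      "\<And>j. j < i \<Longrightarrow> g i \<bullet> p j = 0" "\<And>j. j < i \<Longrightarrow> g i \<bullet> (?W *v g j) = 0"
      "\<And>j. j < i \<Longrightarrow> p i \<bullet> (H *v p j) = 0" if "i \<le> m" for i
      using less.IH[of i] that Suc mN by auto
    have Hp: "p i \<bullet> (H *v p i) > 0" if "i \<le> m" for i
    proof -
      have "p i \<noteq> 0" using IH(1)[OF that] Wpos[of i] that mN by auto
      then show ?thesis using H_pd by (simp add: pos_def_def)
    qed
    have \<theta>: "\<theta> i * (p i \<bullet> (H *v p i)) = g i \<bullet> (?W *v g i)" if "i \<le> m" for i
      using step(1)[of i] Hp[OF that] IH(1)[OF that] that mN by simp
    have \<theta>0: "\<theta> i \<noteq> 0" if "i \<le> m" for i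
      using \<theta>[OF that] Wpos[of i] that mN by auto
    have gp: "g n \<bullet> p j = 0" if "j < n" for j
    proof (cases "j = m")
      case True
      then show ?thesis using \<theta>[of m] IH(1)[of m]
        by (simp add: Suc step(2)[OF mN] inner_add_left inner_commute[of "H *v p m"])
    next
      case False
      then have "j < m" using that Suc by simp
      moreover have "(H *v p m) \<bullet> p j = p m \<bullet> (H *v p j)"
        using symmetric_inner_mult_vec[OF H_sym] by metis
      ultimately show ?thesis using IH(2,4)[of m j]
        by (simp add: Suc step(2)[OF mN] inner_add_left)
    qed
    have gW: "g n \<bullet> (?W *v g j) = 0" if "j < n" for j
    proof (cases j)
      case 0
      then have "?W *v g j = - p 0" using p0 by simp
      then show ?thesis using gp[of 0] that by simp
    next
      case (Suc i)
      then have "?W *v g j = - p j + ((g j \<bullet> (?W *v g j)) / (g i \<bullet> (?W *v g i))) *\<^sub>R p i"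
        using pSuc[of i] that less.prems by simp
      then show ?thesis using gp[of i] gp[of j] that Suc
        by (metis (no_types, lifting) Suc_lessD add_0 inner_add_right inner_minus_right
            inner_scaleR_right minus_zero mult_zero_right)
    qed
    have pn: "p n = - (?W *v g n) + ((g n \<bullet> (?W *v g n)) / (g m \<bullet> (?W *v g m))) *\<^sub>R p m"
      using pSuc[of m] Suc less.prems by simp
    have "g n \<bullet> p n = - (g n \<bullet> (?W *v g n))"
      using gp[of m] Suc by (subst pn) (simp add: inner_diff_right)
    moreover have "p n \<bullet> (H *v p j) = 0" if "j < n" for j
    proof -
      have jm: "j \<le> m" using that Suc by simp
      have "H *v p j = (1 / \<theta> j) *\<^sub>R (g (Suc j) - g j)"
        using step(2)[of j] \<theta>0[OF jm] jm mN by simp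
      then have "(?W *v g n) \<bullet> (H *v p j)
          = (g (Suc j) \<bullet> (?W *v g n) - g j \<bullet> (?W *v g n)) / \<theta> j"
        by (simp add: inner_diff_right inner_commute)
      also have "\<dots> = (g n \<bullet> (?W *v g (Suc j))) / \<theta> j"
        using gW[OF that] matrix_inv_inner_commute[OF M_sym pos_def_imp_invertible[OF M_pd]]
        by simp
      finally have *: "(?W *v g n) \<bullet> (H *v p j) = (g n \<bullet> (?W *v g (Suc j))) / \<theta> j" .
      \<comment> \<open>For \<open>j = m\<close> the numerator is
        \<open>g n \<bullet> (?W *v g n)\<close>, and the coefficient of \<open>p m\<close> in
        \<open>p n\<close> cancels it exactly. For smaller \<open>j\<close> it vanishes because
        \<open>Suc j < n\<close>.\<close>
      show ?thesis
      proof (cases "j = m")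
        case True
        have "(g m \<bullet> (?W *v g m)) = \<theta> m * (p m \<bullet> (H *v p m))" using \<theta> by simp
        then show ?thesis
          using * True Suc \<theta>0[of m] Hp[of m] by (subst pn) (simp add: inner_diff_left)
      next
        case False
        then have "j < m" using jm by simp
        then show ?thesis
          using * gW[of "Suc j"] IH(4)[of m j] Suc by (subst pn) (simp add: inner_diff_left)
      qed
    qed
    ultimately show ?thesis using gp gW by blast
  qed
qed

text \<open>The step \<open>\<theta> i *\<^sub>R p i\<close> does not change when \<open>p i\<close>
  is scaled by a nonzero factor. Step \<open>i\<close> needs nonzero gradients only up to
  \<open>i\<close>, so the conclusion reaches index \<open>k\<close> itself.\<close>

lemma parallel_directions_same_gradients:
  assumes run: "exact_linesearch H c x g p \<theta>" and runP: "exact_linesearch H c xP gP pP \<theta>P"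
    and start: "xP 0 = x 0"
    and nz: "\<forall>i<k. g i \<noteq> 0"
    and parallel: "\<forall>i<k. \<delta> i \<noteq> 0 \<and> p i = \<delta> i *\<^sub>R pP i"
    and "i \<le> k"
  shows "gP i = g i"
  using \<open>i \<le> k\<close>
proof (induction i rule: less_induct)
  case (less i)
  show ?case
  proof (cases i)
    case 0
    then show ?thesis using run runP start by (simp add: exact_linesearch_def)
  next
    case (Suc m)
    have IH: "gP j = g j" if "j \<le> m" for j using less that Suc by simp
    have nz': "\<forall>j\<le>m. g j \<noteq> 0" "\<forall>j\<le>m. gP j \<noteq> 0" using nz IH less.prems Suc by auto
    have p: "\<delta> m \<noteq> 0" "p m = \<delta> m *\<^sub>R pP m" using parallel less.prems Suc by auto
    have "\<theta> m = - (g m \<bullet> p m) / (p m \<bullet> (H *v p m))"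
      "g (Suc m) = g m + \<theta> m *\<^sub>R (H *v p m)"
      using run nz' unfolding exact_linesearch_def by blast+
    moreover have "\<theta>P m = - (gP m \<bullet> pP m) / (pP m \<bullet> (H *v pP m))"
      "gP (Suc m) = gP m + \<theta>P m *\<^sub>R (H *v pP m)"
      using runP nz' unfolding exact_linesearch_def by blast+
    ultimately show ?thesis
      using p IH[of m] by (simp add: Suc matrix_vector_mult_scaleR)
  qed
qed

theorem proposition6p3:
  fixes H M :: "real^'n^'n"
    and c :: "real^'n"
    and x g p :: "nat \<Rightarrow> real^'n" and \<theta> :: "nat \<Rightarrow> real"
    and xP gP pP :: "nat \<Rightarrow> real^'n" and \<theta>P :: "nat \<Rightarrow> real"
    and \<delta> :: "nat \<Rightarrow> real"
    and B :: "nat \<Rightarrow> real^'n^'n"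
    and k :: nat
  assumes H_sym: "transpose H = H" and H_pd: "pos_def H"
    and M_sym: "transpose M = M" and M_pd: "pos_def M"
    and run: "exact_linesearch H c x g p \<theta>"
    and k_ge: "1 \<le> k"
    and k_less_r: "\<forall>i\<le>k. g i \<noteq> 0"
    and pcg_run: "pcg H c M xP gP pP \<theta>P"
    and same_start: "xP 0 = x 0"
    and parallel: "\<forall>i<k. \<delta> i \<noteq> 0 \<and> p i = \<delta> i *\<^sub>R pP i"
    and Bk: "B k *v p k = - g k"
    and B_prev_inv: "invertible (B (k - 1))"
    and B_prev_p: "B (k - 1) *v p (k - 1) = - g (k - 1)"
    and B_prev_g: "B (k - 1) *v (matrix_inv M *v g k) = g k"
  shows
    "(\<forall>t. t \<noteq> 0 \<and> t \<noteq> gamma_hat M g p k \<and> t \<noteq> 1 \<and>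
          B k = rank_one_update (B (k - 1)) g p k t \<longrightarrow>
        invertible (B k) \<and> p k = delta_of M g p k t *\<^sub>R pP k)
     \<and>
     (\<forall>d. d \<noteq> 0 \<and> d \<noteq> delta_of M g p k 1 \<and> d \<noteq> 1 \<and>
          p k = d *\<^sub>R pP k \<and>
          transpose (B k - B (k - 1)) = B k - B (k - 1) \<and> rank (B k - B (k - 1)) = 1 \<longrightarrow>
        invertible (B k) \<and>
        B k = rank_one_update (B (k - 1)) g p k (gamma_of M g p k d))
     \<and>
     (transpose (B (k - 1)) = B (k - 1) \<and> pos_def (B (k - 1)) \<longrightarrow>
       (\<forall>t. t \<noteq> 0 \<and> t \<noteq> gamma_hat M g p k \<and> t \<noteq> 1 \<and>
            B k = rank_one_update (B (k - 1)) g p k t \<longrightarrow>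
          (pos_def (B k) \<longleftrightarrow> t > 1 \<or> (gamma_hat M g p k < t \<and> t < 0)) \<and>
          (pos_def (B k) \<longleftrightarrow>
             (\<exists>d. ((0 < d \<and> d < delta_of M g p k 1) \<or> d > 1) \<and> t = gamma_of M g p k d))))
     \<and>
     (\<forall>\<gamma> :: nat \<Rightarrow> real.
        B 0 = M \<and> (\<forall>i\<le>k. B i *v p i = - g i) \<and>
        (\<forall>i\<in>{1..k}. \<gamma> i \<noteq> 0 \<and> \<gamma> i \<noteq> gamma_hat M g p i \<and> \<gamma> i \<noteq> 1 \<and>
           B i = rank_one_update (B (i - 1)) g p i (\<gamma> i)) \<longrightarrow>
        (\<forall>i<k. B k *v p i = (\<gamma> (i + 1) * \<theta> i / (\<gamma> (i + 1) - 1)) *\<^sub>R (H *v p i)))"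
proof -
  note One_nat_def [simp del]
  define W where "W = matrix_inv M"
  define a where "a = g k \<bullet> (W *v g k)"
  define s where "s = p (k - 1) \<bullet> g (k - 1)"
  let ?q = "p (k - 1)" and ?P = "pP k" and ?B = "B (k - 1)"
  let ?R = "rank_one_update ?B g p k"
  define u where "u t = t *\<^sub>R g k - g (k - 1)" for t
  define y where "y t = t *\<^sub>R (W *v g k) + ?q" for t
  have hat: "gamma_hat M g p k = s / a" and of_d: "\<And>d. gamma_of M g p k d = - (s / a) * (1 / d - 1)"
    and of_t: "\<And>t. delta_of M g p k t = 1 / (1 - t * (a / s))"
    by (simp_all add: gamma_hat_def gamma_of_def delta_of_def a_def s_def W_def)
  have R: "?R t = ?B - (1 / ((t - 1) * s)) *\<^sub>R outer (u t) (u t)" for t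
    by (simp add: rank_one_update_def s_def u_def)

  \<comment> \<open>Transfer of the PCG relations to the given run\<close>
  have runP: "exact_linesearch H c xP gP pP \<theta>P" using pcg_run by (simp add: pcg_def)
  have gP: "gP i = g i" if "i \<le> k" for i
    using parallel_directions_same_gradients[OF run runP same_start _ parallel that] k_less_r by simp
  have orth: "g i \<bullet> pP i = - (g i \<bullet> (W *v g i))"
    "\<And>j. j < i \<Longrightarrow> g i \<bullet> pP j = 0" "\<And>j. j < i \<Longrightarrow> g i \<bullet> (W *v g j) = 0" if "i \<le> k" for i
    using pcg_orthogonality[OF H_sym H_pd M_sym M_pd pcg_run _ that] gP k_less_r that
    by (auto simp: W_def)
  have Wpos: "g i \<bullet> (W *v g i) > 0" if "i \<le> k" for i
    using matrix_inv_inner_pos[OF M_pd] k_less_r that by (simp add: W_def)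
  have gp: "g i \<bullet> p j = 0" if "j < i" "i \<le> k" for i j
    using orth(2)[of i j] parallel that by simp
  have pg: "p i \<bullet> g i = - \<delta> i * (g i \<bullet> (W *v g i))" if "i < k" for i
    using orth(1)[of i] parallel that by (simp add: inner_commute)
  have pg0: "p i \<bullet> g i \<noteq> 0" if "i < k" for i
    using pg[OF that] Wpos[of i] parallel that by auto

  \<comment> \<open>Vector and scalar identities at iteration \<open>k\<close>\<close>
  have a: "a > 0" using Wpos by (simp add: a_def)
  have s: "s \<noteq> 0" using pg0 k_ge by (simp add: s_def)
  have gq: "g k \<bullet> ?q = 0" using gp k_ge by simp
  have gWg: "g (k - 1) \<bullet> (W *v g k) = 0"
    using orth(3)[of k "k - 1"] k_ge
      matrix_inv_inner_commute[OF M_sym pos_def_imp_invertible[OF M_pd]]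
    by (simp add: W_def)
  have qg: "g (k - 1) \<bullet> ?q = s" by (simp add: s_def inner_commute)
  \<comment> \<open>Both \<open>?q\<close> and \<open>s\<close> carry the factor
    \<open>\<delta> (k - 1)\<close>, which cancels in \<open>(1 / s) *\<^sub>R ?q\<close>; the
    recurrence thus takes a form free of the scaling.\<close>
  have P: "?P = - (W *v g k) - (a / s) *\<^sub>R ?q"
  proof -
    have "?P = - (W *v g k) + (a / (g (k - 1) \<bullet> (W *v g (k - 1)))) *\<^sub>R pP (k - 1)"
      using pcg_run k_ge k_less_r gP unfolding pcg_def by (auto simp: W_def a_def)
    moreover have "?q = \<delta> (k - 1) *\<^sub>R pP (k - 1)" "\<delta> (k - 1) \<noteq> 0"
      using parallel k_ge by auto
    moreover have "s = - \<delta> (k - 1) * (g (k - 1) \<bullet> (W *v g (k - 1)))"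
      using pg[of "k - 1"] k_ge by (simp add: s_def)
    ultimately show ?thesis by simp
  qed
  have By: "?B *v y t = u t" for t
    using B_prev_p B_prev_g
    by (simp add: y_def u_def W_def matrix_vector_right_distrib matrix_vector_mult_scaleR)
  have uy: "u t \<bullet> y t = t\<^sup>2 * a - s" for t
    by (simp add: u_def y_def inner_diff_left inner_add_right gq gWg qg power2_eq_square flip: a_def)
  have uP: "u t \<bullet> ?P = - a * (t - 1)" for t
    using s by (simp add: u_def P inner_diff_left inner_diff_right gq gWg qg flip: a_def)
      (simp add: algebra_simps)
  have BP: "?B *v ?P = - g k + (a / s) *\<^sub>R g (k - 1)"
    using B_prev_p B_prev_g
    by (simp add: P W_def matrix_vector_mult_diff_distrib matrix_vector_mult_scaleR
        linear_neg[OF matrix_vector_mul_linear])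
  \<comment> \<open>Here \<open>y 0\<close> is \<open>?q\<close>, whose product with
    \<open>u t\<close> is \<open>- s\<close> for every \<open>t\<close>.\<close>
  have u0: "u t \<noteq> 0" for t
  proof
    assume "u t = 0"
    then have "u t \<bullet> y 0 = 0" by simp
    then show False using s by (simp add: y_def u_def inner_diff_left gq qg)
  qed
  \<comment> \<open>The rank-one term adds \<open>(a / s) *\<^sub>R u t\<close>, whose
    \<open>g (k - 1)\<close> part cancels the one in \<open>BP\<close>.\<close>
  have RP: "?R t *v ?P = - (1 - t * (a / s)) *\<^sub>R g k" if "t \<noteq> 1" for t
  proof -
    have co: "1 / ((t - 1) * s) * (u t \<bullet> ?P) = - (a / s)"
      using that s by (simp add: uP field_simps)
    show ?thesis
      unfolding R rank_one_diff_mult_vec BP co by (simp add: u_def algebra_simps)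
  qed
  \<comment> \<open>The factored form shows that the roots are \<open>0\<close> and
    \<open>s / a\<close>, the latter being \<open>gamma_hat\<close>.\<close>
  have scalar: "1 - 1 / ((t - 1) * s) * (u t \<bullet> y t) = a * t * (s / a - t) / ((t - 1) * s)"
    if "t \<noteq> 1" for t
    using that s a by (simp add: uy field_simps power2_eq_square)
  have inv: "invertible (?R t)" if "t \<noteq> 0" "t \<noteq> s / a" "t \<noteq> 1" for t
    unfolding R
  proof (rule invertible_rank_one_diff[OF B_prev_inv By])
    have "a * t * (s / a - t) / ((t - 1) * s) \<noteq> 0" using that a s by simp
    then show "1 / ((t - 1) * s) * (u t \<bullet> y t) \<noteq> 1"
      unfolding scalar[OF that(3), symmetric] by simp
  qed

  \<comment> \<open>From the update to the direction\<close>
  have part1: "invertible (B k) \<and> p k = delta_of M g p k t *\<^sub>R ?P"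
    if t: "t \<noteq> 0" "t \<noteq> s / a" "t \<noteq> 1" and Bt: "B k = ?R t" for t
  proof
    show "invertible (B k)" using inv t Bt by simp
    have "1 - t * (a / s) \<noteq> 0" using t(2) a s by (simp add: field_simps)
    then have "delta_of M g p k t * - (1 - t * (a / s)) = - 1"
      unfolding of_t by (metis mult_minus_right nonzero_eq_divide_eq)
    then have "B k *v (delta_of M g p k t *\<^sub>R ?P) = - g k"
      unfolding Bt matrix_vector_mult_scaleR RP[OF t(3)] scaleR_scaleR by simp
    \<comment> \<open>Both vectors solve the same system with right-hand side \<open>- g k\<close>,
      so nonsingularity identifies them.\<close>
    then have "B k *v (p k - delta_of M g p k t *\<^sub>R ?P) = 0"
      by (simp add: matrix_vector_mult_diff_distrib Bk)
    then show "p k = delta_of M g p k t *\<^sub>R ?P"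
      using \<open>invertible (B k)\<close> unfolding invertible_iff_ker by fastforce
  qed

  \<comment> \<open>From the direction to the update\<close>
  have part2: "invertible (B k) \<and> B k = ?R (gamma_of M g p k d)"
    if d: "d \<noteq> 0" "d \<noteq> delta_of M g p k 1" "d \<noteq> 1" and pk: "p k = d *\<^sub>R ?P"
      and sym: "transpose (B k - ?B) = B k - ?B" and rank: "rank (B k - ?B) = 1" for d
  proof -
    define t where "t = gamma_of M g p k d"
    have t: "t = (s / a) * (d - 1) / d" using d(1) a by (simp add: t_def of_d field_simps)
    have t0: "t \<noteq> 0" using t d s a by simp
    have t1: "t \<noteq> 1"
    proof
      assume "t = 1"
      then have "1 / d = 1 - a / s" using t d(1) s a by (simp add: field_simps)
      \<comment> \<open>Taking reciprocals also covers \<open>a = s\<close>, where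
        \<open>delta_of\<close> at 1 is the default value 0.\<close>
      then have "d = 1 / (1 - a / s)" using d(1) by (metis div_by_1 divide_divide_eq_right mult_1)
      then show False using d(2) by (simp add: of_t)
    qed
    have th: "t \<noteq> s / a" unfolding t using d(1) s a by (simp add: field_simps)
    \<comment> \<open>This is minus the coefficient of \<open>g (k - 1)\<close> in the value of
      \<open>B k - ?B\<close> at \<open>p k\<close>. Factoring it out leaves \<open>u t\<close>,
      precisely because \<open>t\<close> is \<open>gamma_of\<close> at \<open>d\<close>.\<close>
    define e where "e = d * a / s"
    have e: "e \<noteq> 0" using d a s by (simp add: e_def)
    have et: "e * t = d - 1" using t d(1) s a by (simp add: e_def)
    have "(B k - ?B) *v p k = - g k - d *\<^sub>R (- g k + (a / s) *\<^sub>R g (k - 1))"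
      by (simp add: matrix_vector_mult_diff_rdistrib Bk)
        (simp add: pk matrix_vector_mult_scaleR BP)
    also have "\<dots> = (d - 1) *\<^sub>R g k - e *\<^sub>R g (k - 1)"
      by (simp add: algebra_simps e_def)
    also have "\<dots> = e *\<^sub>R u t"
      by (simp add: u_def scaleR_diff_right et)
    finally have w: "(B k - ?B) *v p k = e *\<^sub>R u t" .
    have "e *\<^sub>R u t \<noteq> 0" using e u0 by simp
    note A = symmetric_rank_one_eq_outer(2)[OF sym rank w this]
    \<comment> \<open>With \<open>d * a = e * s\<close> the inner product acquires the same factor
      \<open>e * e\<close> as the outer product, so the scale drops out of the quotient.\<close>
    have "e *\<^sub>R u t \<bullet> p k = - (e * e * (t - 1) * s)"
      using s by (simp add: pk uP e_def)
    moreover have "outer (e *\<^sub>R u t) (e *\<^sub>R u t) = (e * e) *\<^sub>R outer (u t) (u t)"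
      by (simp add: outer_def vec_eq_iff)
    ultimately have "B k - ?B = - (1 / ((t - 1) * s)) *\<^sub>R outer (u t) (u t)"
      using A e by simp
    then have "B k = ?R t" unfolding R by (simp add: algebra_simps)
    then show ?thesis using inv[OF t0 th t1] by (simp add: t_def)
  qed

  \<comment> \<open>Positive definiteness of the update\<close>
  have part3: "(pos_def (B k) \<longleftrightarrow> t > 1 \<or> (s / a < t \<and> t < 0)) \<and>
      (pos_def (B k) \<longleftrightarrow>
        (\<exists>d. ((0 < d \<and> d < delta_of M g p k 1) \<or> d > 1) \<and> t = gamma_of M g p k d))"
    if sym: "transpose ?B = ?B" and pd: "pos_def ?B"
      and t: "t \<noteq> 0" "t \<noteq> s / a" "t \<noteq> 1" and Bt: "B k = ?R t" for t
  proof -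
    \<comment> \<open>Definiteness of \<open>?B\<close> enters through
      \<open>?q \<bullet> (?B *v ?q) = - s\<close>; it fixes the sign of \<open>s\<close> and hence
      of \<open>h\<close>, on which the sign analysis rests.\<close>
    have "?q \<noteq> 0" using s by (auto simp: s_def)
    then have "?q \<bullet> (?B *v ?q) > 0" using pd by (simp add: pos_def_def)
    then have sneg: "s < 0" by (simp add: B_prev_p s_def)
    define h where "h = s / a"
    have h: "h < 0" using sneg a by (simp add: h_def divide_neg_pos)
    have ash: "a / s = 1 / h" by (simp add: h_def)
    have "pos_def (B k) \<longleftrightarrow> 0 < 1 - 1 / ((t - 1) * s) * (u t \<bullet> y t)"
      unfolding Bt R pos_def_rank_one_diff_iff[OF sym pd By u0] by simp
    also have "\<dots> \<longleftrightarrow> 0 < a * t * (h - t) / ((t - 1) * s)"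
      unfolding scalar[OF t(3)] h_def ..
    also have "\<dots> \<longleftrightarrow> t > 1 \<or> (h < t \<and> t < 0)"
      using a sneg h t
      by (auto simp: zero_less_divide_iff zero_less_mult_iff mult_less_0_iff h_def[symmetric])
    finally have pd_iff: "pos_def (B k) \<longleftrightarrow> t > 1 \<or> (h < t \<and> t < 0)" .
    \<comment> \<open>As \<open>h < 0\<close>, the map from \<open>d\<close> to
      \<open>h * (1 - 1 / d)\<close> is decreasing for positive \<open>d\<close>: it takes
      \<open>delta_of\<close> at 1 to 1 when that value is positive, takes 1 to 0, and tends to
      \<open>h\<close> at infinity. This matches the two \<open>d\<close>-ranges with the two
      \<open>t\<close>-ranges.\<close>
    have dd: "(0 < d \<and> d < delta_of M g p k 1) \<longleftrightarrow> 0 < d \<and> h * (1 - 1 / d) > 1" for d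
    proof (cases "0 < d")
      case True
      have "1 - 1 / h > 0" using h by (simp add: field_simps)
      then have "d < delta_of M g p k 1 \<longleftrightarrow> 1 - 1 / h < 1 / d"
        using True by (simp add: of_t ash less_divide_eq mult.commute)
      also have "\<dots> \<longleftrightarrow> 1 - 1 / d < 1 / h" by auto
      also have "\<dots> \<longleftrightarrow> h * (1 - 1 / d) > 1"
        using h by (simp add: neg_less_divide_eq mult.commute)
      finally show ?thesis using True by simp
    qed simp
    have dd1: "d > 1 \<longleftrightarrow> 0 < d \<and> h < h * (1 - 1 / d) \<and> h * (1 - 1 / d) < 0" for d
    proof (cases "0 < d")
      case True
      then show ?thesis using h by (simp add: mult_less_0_iff less_divide_eq field_simps)
    qed simp
    have od: "gamma_of M g p k d = h * (1 - 1 / d)" for d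
      by (simp add: of_d h_def algebra_simps)
    have "(\<exists>d. ((0 < d \<and> d < delta_of M g p k 1) \<or> d > 1) \<and> t = gamma_of M g p k d)
        \<longleftrightarrow> t > 1 \<or> (h < t \<and> t < 0)" (is "?L \<longleftrightarrow> ?Q")
    proof
      assume ?L
      then show ?Q using dd dd1 od by metis
    next
      assume Q: ?Q
      have "t / h < 1"
        using Q h by (auto simp: neg_divide_less_eq)
      \<comment> \<open>The witness is \<open>delta_of\<close> at \<open>t\<close>; it is positive
        since \<open>t > h\<close> in both ranges.\<close>
      define d where "d = 1 / (1 - t / h)"
      have d: "d > 0" using \<open>t / h < 1\<close> by (simp add: d_def)
      have "h * (1 - 1 / d) = t" using \<open>t / h < 1\<close> h by (simp add: d_def)
      then show ?L using dd[of d] dd1[of d] od[of d] d Q by metis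
    qed
    with pd_iff show ?thesis by (simp add: h_def)
  qed

  \<comment> \<open>Action on the earlier directions\<close>
  have part4: "B k *v p i = (\<gamma> (i + 1) * \<theta> i / (\<gamma> (i + 1) - 1)) *\<^sub>R (H *v p i)"
    if Bi: "\<forall>i\<le>k. B i *v p i = - g i"
      and up: "\<forall>i\<in>{1..k}. \<gamma> i \<noteq> 1 \<and> B i = rank_one_update (B (i - 1)) g p i (\<gamma> i)"
      and i: "i < k" for \<gamma> i
  proof -
    have upd: "B (Suc j) *v z = B j *v z - (1 / ((\<gamma> (Suc j) - 1) * (p j \<bullet> g j))
        * ((\<gamma> (Suc j) *\<^sub>R g (Suc j) - g j) \<bullet> z)) *\<^sub>R (\<gamma> (Suc j) *\<^sub>R g (Suc j) - g j)"
      if "j < k" for j z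
    proof -
      have "B (Suc j) = rank_one_update (B j) g p (Suc j) (\<gamma> (Suc j))"
        using up that by (metis Suc_leI atLeastAtMost_iff diff_Suc_1 le_add1 plus_1_eq_Suc)
      then show ?thesis by (simp add: rank_one_update_def rank_one_diff_mult_vec)
    qed
    have later: "B j *v p i = B (Suc i) *v p i" if "Suc i \<le> j" "j \<le> k" for j
      using that
    proof (induction j rule: dec_induct)
      case (step j)
      then show ?case using upd[of j "p i"] gp[of i j] gp[of i "Suc j"]
        by (simp add: inner_diff_left)
    qed simp
    have Bki: "B k *v p i = B (Suc i) *v p i" using later[of k] i by linarith
    define t where "t = \<gamma> (Suc i)"
    have t1: "t \<noteq> 1" using up i by (simp add: t_def)
    \<comment> \<open>Since \<open>g (Suc i)\<close> is orthogonal to \<open>p i\<close>, only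
      \<open>- (g i \<bullet> p i)\<close> survives and cancels the denominator.\<close>
    have co: "1 / ((t - 1) * (p i \<bullet> g i)) * ((t *\<^sub>R g (Suc i) - g i) \<bullet> p i) = - (1 / (t - 1))"
      using gp[of i "Suc i"] pg0[OF i] i by (simp add: inner_diff_left inner_commute[of "p i"])
    have "B (Suc i) *v p i = - g i + (1 / (t - 1)) *\<^sub>R (t *\<^sub>R g (Suc i) - g i)"
      using upd[OF i, of "p i"] Bi i unfolding t_def[symmetric] co by simp
    also have "\<dots> = (t / (t - 1)) *\<^sub>R g (Suc i) - (1 + 1 / (t - 1)) *\<^sub>R g i"
      by (simp add: algebra_simps)
    also have "1 + 1 / (t - 1) = t / (t - 1)" using t1 by (simp add: field_simps)
    also have "(t / (t - 1)) *\<^sub>R g (Suc i) - (t / (t - 1)) *\<^sub>R g i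
        = (t / (t - 1)) *\<^sub>R (g (Suc i) - g i)"
      by (simp add: scaleR_diff_right)
    also have "g (Suc i) - g i = \<theta> i *\<^sub>R (H *v p i)"
      using run k_less_r i unfolding exact_linesearch_def by simp
    finally show ?thesis using Bki by (simp add: t_def One_nat_def)
  qed

  show ?thesis
    unfolding hat
    by (intro conjI allI impI; use part1 part2 part3 part4 in blast)
qed

end
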